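(* Consider a time-homogeneous absorbing discrete-time Markov chain on the finite state space $\Omega=\{1,\dots,|\Omega|\}$ with transition matrix $P=\begin{bmatrix} Q & R\\ 0 & I\end{bmatrix}$ in canonical form (transient states first), and impulse-reward matrix $\Theta=\begin{bmatrix}\Theta_1 & \Theta_2\\ 0 & 0\end{bmatrix}$. Let $H=\Theta\odot P=\begin{bmatrix} H_1 & H_2\\ 0&0\end{bmatrix}$ and $N=(I-Q)^{-1}$. For every $i\in\Omega$, the long-term expected accumulated reward $\bar R_\infty(i)=\lim_{n\to\infty}\mathbb E(R_n\mid S_0=i)$ satisfies $$\bar R_\infty(i)=\sum_{j=1}^{|\Omega|}\hat R_\infty(i,j),$$ where $\hat R_\infty(i,j)=\lim_{n\to\infty}\hat R_n(i,j)$ and the matrix $\hat R_\infty=(\hat R_\infty(i,j))$ is given by $$\hat R_\infty=\begin{bmatrix}0 & N(H_2+H_1NR)\\ 0&0\end{bmatrix}.$$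
   Context: Let $S_0,S_1,\dots$ be a time-homogeneous Markov chain on a finite state space $\Omega=\{1,\dots,|\Omega|\}$ with transition probabilities $p_{ij}=\Pr(S_n=j\mid S_{n-1}=i)$ and transition matrix $P=(p_{ij})$. A state $i$ is absorbing if $p_{ii}=1$ (so $p_{ij}=0$ for $j\ne i$), and is transient otherwise. The chain is absorbing: there is at least one absorbing state, and from every transient state some absorbing state can be reached in finitely many transitions. Let $\Omega_T$ and $\Omega_A$ be the sets of transient and absorbing states; transient states have lower indices than absorbing states, so $P=\begin{bmatrix} Q & R\\ 0 & I\end{bmatrix}$ with $Q$ of size $|\Omega_T|\times|\Omega_T|$ and $R$ of size $|\Omega_T|\times|\Omega_A|$. The matrix $I-Q$ is invertible and $N=(I-Q)^{-1}$ is called the fundamental matrix. The impulse-reward matrix $\Theta=(\rho_{ij})$ is a real $|\Omega|\times|\Omega|$ matrix, $\rho_{ij}$ being the reward accumulated on a transition from $i$ to $j$. Transitions out of absorbing states carry zero reward, so $\Theta=\begin{bmatrix}\Theta_1 & \Theta_2\\ 0&0\end{bmatrix}$ with $\Theta_1$ of size $|\Omega_T|\times|\Omega_T|$ and $\Theta_2$ of size $|\Omega_T|\times|\Omega_A|$. $H=\Theta\odot P$ is the entrywise (Hadamard) product, $H(i,j)=\rho_{ij}p_{ij}$, with blocks $H_1,H_2$ partitioned in the same way. The accumulated reward at time $n\ge1$ is the random variable $R_n=\sum_{k=1}^{n}\rho_{S_{k-1}S_k}$ (not to be confused with the matrix $R$). Set $\bar R_n(i,j)=\mathbb E(R_n\mid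 S_0=i,S_n=j)$ and $\hat R_n(i,j)=\bar R_n(i,j)\cdot\Pr(S_n=j\mid S_0=i)$, with $\hat R_n(i,j)=0$ when $\Pr(S_n=j\mid S_0=i)=0$. *)

theory Defs
  imports
    "HOL-Probability.Probability"
    "Jordan_Normal_Form.Gauss_Jordan_Elimination"
begin

text \<open>
  States are numbered from 0, in accordance with the indexing of matrices: the state space is
  \<open>{..<m}\<close>, where \<open>m\<close> is the dimension of the transition matrix.
\<close>

definition stochastic_mat :: "real mat \<Rightarrow> bool" where
  "stochastic_mat P \<longleftrightarrow> square_mat P \<and>
     (\<forall>i<dim_row P. (\<forall>j<dim_col P. 0 \<le> P $$ (i, j)) \<and> (\<Sum>j<dim_col P. P $$ (i, j)) = 1)"

text \<open>
  The initial distribution, that is, the law of \<open>S 0\<close>, is arbitrary. The transition law is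
  imposed only after histories \<open>S 0 = x 0, \<dots>, S n = x n\<close> of positive probability, because
  \<^const>\<open>cond_prob\<close> is 0 when the conditioning event is a null event.
\<close>

definition markov_chain :: "'w measure \<Rightarrow> (nat \<Rightarrow> 'w \<Rightarrow> nat) \<Rightarrow> real mat \<Rightarrow> bool" where
  "markov_chain M S P \<longleftrightarrow>
     prob_space M \<and> stochastic_mat P \<and>
     (\<forall>n. S n \<in> measurable M (count_space {..<dim_row P})) \<and>
     (\<forall>n x. \<P>(\<omega> in M. \<forall>k\<le>n. S k \<omega> = x k) > 0 \<longrightarrow>
        (\<forall>j<dim_row P.
           \<P>(\<omega> in M. S (Suc n) \<omega> = j \<bar> \<forall>k\<le>n. S k \<omega> = x k) = P $$ (x n, j)))"

definition absorbing_states :: "real mat \<Rightarrow> nat set" where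
  "absorbing_states P = {i. i < dim_row P \<and> P $$ (i, i) = 1}"

definition transient_states :: "real mat \<Rightarrow> nat set" where
  "transient_states P = {i. i < dim_row P \<and> P $$ (i, i) \<noteq> 1}"

definition transitions :: "real mat \<Rightarrow> (nat \<times> nat) set" where
  "transitions P = {(i, j). i < dim_row P \<and> j < dim_col P \<and> P $$ (i, j) > 0}"

definition absorbing_chain :: "real mat \<Rightarrow> bool" where
  "absorbing_chain P \<longleftrightarrow> absorbing_states P \<noteq> {} \<and>
     (\<forall>i\<in>transient_states P. \<exists>j\<in>absorbing_states P. (i, j) \<in> (transitions P)\<^sup>*)"

definition hadamard_prod :: "real mat \<Rightarrow> real mat \<Rightarrow> real mat" where
  "hadamard_prod A B = Matrix.mat (dim_row A) (dim_col A) (\<lambda>ij. A $$ ij * B $$ ij)"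

definition fundamental_matrix :: "real mat \<Rightarrow> real mat" where
  "fundamental_matrix Q = the (mat_inverse (1\<^sub>m (dim_row Q) - Q))"

definition accumulated_reward :: "real mat \<Rightarrow> (nat \<Rightarrow> 'w \<Rightarrow> nat) \<Rightarrow> nat \<Rightarrow> 'w \<Rightarrow> real" where
  "accumulated_reward \<Theta> S n \<omega> = (\<Sum>k=1..n. \<Theta> $$ (S (k - 1) \<omega>, S k \<omega>))"

text \<open>
  The elementary conditional expectation \<open>E(X | A) = E(X 1\<^sub>A) / Pr(A)\<close> given the event
  \<open>A\<close> of all \<open>\<omega>\<close> with \<open>B \<omega>\<close>. Like \<^const>\<open>cond_prob\<close>, it is meaningful only if
  this event has positive probability.
\<close>

definition cond_expectation :: "'w measure \<Rightarrow> ('w \<Rightarrow> real) \<Rightarrow> ('w \<Rightarrow> bool) \<Rightarrow> real" where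
  "cond_expectation M X B =
     (\<integral>\<omega>. X \<omega> * indicator {\<omega> \<in> space M. B \<omega>} \<omega> \<partial>M) / \<P>(\<omega> in M. B \<omega>)"

definition expected_reward ::
    "'w measure \<Rightarrow> (nat \<Rightarrow> 'w \<Rightarrow> nat) \<Rightarrow> real mat \<Rightarrow> nat \<Rightarrow> nat \<Rightarrow> real" where
  "expected_reward M S \<Theta> n i =
     cond_expectation M (accumulated_reward \<Theta> S n) (\<lambda>\<omega>. S 0 \<omega> = i)"

definition R_bar ::
    "'w measure \<Rightarrow> (nat \<Rightarrow> 'w \<Rightarrow> nat) \<Rightarrow> real mat \<Rightarrow> nat \<Rightarrow> nat \<Rightarrow> nat \<Rightarrow> real" where
  "R_bar M S \<Theta> n i j =
     cond_expectation M (accumulated_reward \<Theta> S n) (\<lambda>\<omega>. S 0 \<omega> = i \<and> S n \<omega> = j)"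

definition R_hat ::
    "'w measure \<Rightarrow> (nat \<Rightarrow> 'w \<Rightarrow> nat) \<Rightarrow> real mat \<Rightarrow> nat \<Rightarrow> nat \<Rightarrow> nat \<Rightarrow> real" where
  "R_hat M S \<Theta> n i j =
     (let p = \<P>(\<omega> in M. S n \<omega> = j \<bar> S 0 \<omega> = i)
      in if p = 0 then 0 else R_bar M S \<Theta> n i j * p)"

definition R_bar_inf :: "'w measure \<Rightarrow> (nat \<Rightarrow> 'w \<Rightarrow> nat) \<Rightarrow> real mat \<Rightarrow> nat \<Rightarrow> real" where
  "R_bar_inf M S \<Theta> i = lim (\<lambda>n. expected_reward M S \<Theta> n i)"

definition R_hat_inf ::
    "'w measure \<Rightarrow> (nat \<Rightarrow> 'w \<Rightarrow> nat) \<Rightarrow> real mat \<Rightarrow> nat \<Rightarrow> nat \<Rightarrow> real" where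
  "R_hat_inf M S \<Theta> i j = lim (\<lambda>n. R_hat M S \<Theta> n i j)"

end

theory Submission
  imports Defs "Jordan_Normal_Form.Determinant"
begin

text \<open>
  For a fixed initial state \<open>i\<close>, the masses \<open>u n j = E(1[S 0 = i, S n = j])\<close> and
  \<open>w n j = E(R n 1[S 0 = i, S n = j])\<close> satisfy \<open>u (n+1) = u n P\<close> and
  \<open>w (n+1) = w n P + u n H\<close>. On the transient states \<open>Q\<close> is a strict contraction for a weighted
  l1-norm, so there both sequences are summable; summing the recursions gives, up to the factor
  \<open>Pr(S 0 = i)\<close>, row \<open>i\<close> of \<open>N\<close> for \<open>u\<close> and row \<open>i\<close> of \<open>N H1 N\<close> for \<open>w\<close>. At an absorbing
  state, \<open>w\<close> increases by \<open>w n R + u n H2\<close> in each step, so its limit is row \<open>i\<close> of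
  \<open>N H1 N R + N H2\<close>.
\<close>

section \<open>Strict contraction on the transient states\<close>

text \<open>
  The weight is \<open>v i = 1 - e ^ d i\<close>, where \<open>d i\<close> is the number of steps needed to reach an absorbing
  state and \<open>2 e\<close> is at most every positive transition probability: a step from \<open>i\<close> towards
  absorption lowers the mean of \<open>v\<close> enough to make \<open>v\<close> strictly superharmonic.
\<close>

lemma absorbing_chain_weight:
  assumes stoch: "stochastic_mat P" and abs: "absorbing_chain P"
  obtains v :: "nat \<Rightarrow> real" and r :: real
  where "r < 1" and "\<And>i. i \<in> transient_states P \<Longrightarrow> 0 < v i"
    and "\<And>i. i \<in> transient_states P \<Longrightarrow> (\<Sum>j\<in>transient_states P. P $$ (i, j) * v j) \<le> r * v i"
proof -
  let ?m = "dim_row P" and ?T = "transient_states P" and ?A = "absorbing_states P"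
  let ?E = "transitions P"
  have sq: "dim_col P = ?m" using stoch by (simp add: stochastic_mat_def)
  have nonneg: "0 \<le> P $$ (i, j)" if "i < ?m" "j < ?m" for i j
    using stoch that sq by (simp add: stochastic_mat_def)
  have row: "(\<Sum>j<?m. P $$ (i, j)) = 1" if "i < ?m" for i
    using stoch that sq by (simp add: stochastic_mat_def)
  have fin: "finite ?T" by (simp add: transient_states_def)
  have TA: "?T \<union> ?A = {..<?m}" "?T \<inter> ?A = {}"
    by (auto simp: transient_states_def absorbing_states_def)
  define hits where "hits i n \<longleftrightarrow> (\<exists>j\<in>?A. (i, j) \<in> ?E ^^ n)" for i n
  define d where "d i = (LEAST n. hits i n)" for i
  have ex: "\<exists>n. hits i n" if "i < ?m" for i
  proof (cases "i \<in> ?T")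
    case True
    then show ?thesis
      using abs by (auto simp: absorbing_chain_def hits_def dest: rtrancl_imp_relpow)
  next
    case False
    then have "hits i 0" using that TA by (auto simp: hits_def)
    then show ?thesis ..
  qed
  have d_hits: "hits i (d i)" if "i < ?m" for i
    unfolding d_def using ex[OF that] by (rule LeastI_ex)
  \<comment> \<open>The first transition of a shortest path to absorption leads to a state whose
    distance \<open>d\<close> is smaller by at least one.\<close>
  have closer: "\<exists>k<?m. P $$ (i, k) > 0 \<and> Suc (d k) \<le> d i" if "i \<in> ?T" for i
  proof -
    have "i < ?m" using that TA by auto
    obtain j where j: "j \<in> ?A" "(i, j) \<in> ?E ^^ d i" using d_hits[OF \<open>i < ?m\<close>] by (auto simp: hits_def)
    have "d i \<noteq> 0" using j that TA by (intro notI) auto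
    then obtain n where n: "d i = Suc n" by (cases "d i") auto
    obtain k where k: "(i, k) \<in> ?E" "(k, j) \<in> ?E ^^ n"
      using j(2) unfolding n by (meson relpow_Suc_D2)
    have "hits k n" using k j by (auto simp: hits_def)
    then have "d k \<le> n" unfolding d_def by (rule Least_le)
    then show ?thesis using k(1) n sq by (auto simp: transitions_def)
  qed
  define pos where "pos = {P $$ (i, j) | i j. i < ?m \<and> j < ?m \<and> P $$ (i, j) > 0}"
  have "pos \<subseteq> (\<lambda>(i, j). P $$ (i, j)) ` ({..<?m} \<times> {..<?m})" by (auto simp: pos_def)
  then have fin_pos: "finite (insert 1 pos)" by (auto intro: finite_subset)
  \<comment> \<open>Inserting 1 keeps the set nonempty for \<open>Min\<close> and ensures
    \<open>e\<close> < 1.\<close>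
  define e where "e = Min (insert 1 pos) / 2"
  have e: "0 < e" "e < 1"
  proof -
    have "0 < Min (insert 1 pos)" using fin_pos by (subst Min_gr_iff) (auto simp: pos_def)
    moreover have "Min (insert 1 pos) \<le> 1" using fin_pos by (intro Min_le) auto
    ultimately show "0 < e" "e < 1" by (auto simp: e_def)
  qed
  have le_pos: "2 * e \<le> P $$ (i, j)" if "i < ?m" "j < ?m" "P $$ (i, j) > 0" for i j
    using fin_pos that unfolding e_def by (auto intro!: Min_le simp: pos_def)
  define v where "v i = 1 - e ^ d i" for i
  \<comment> \<open>The sum is a crude uniform bound on the distances of transient states; it makes
    the rate \<open>1 - e ^ D\<close> independent of the state.\<close>
  define D where "D = (\<Sum>i\<in>?T. d i)"
  have D: "d i \<le> D" if "i \<in> ?T" for i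
    unfolding D_def using fin that by (intro member_le_sum) auto
  have v_nonneg: "0 \<le> v i" for i using e by (simp add: v_def power_le_one)
  show thesis
  proof
    show "1 - e ^ D < 1" using e by simp
    fix i assume i: "i \<in> ?T"
    then have im: "i < ?m" using TA by auto
    obtain k where k: "k < ?m" "P $$ (i, k) > 0" "Suc (d k) \<le> d i" using closer[OF i] by blast
    have "e ^ d i < 1" using e k by (cases "d i") (auto intro: power_Suc_less_one simp del: power_Suc)
    then show "0 < v i" by (simp add: v_def)
    \<comment> \<open>A single entry of the row suffices: the one towards the closer state
      \<open>k\<close> is at least \<open>2 * e\<close>, and the other terms are
      nonnegative.\<close>
    have "2 * e ^ d i \<le> 2 * e ^ Suc (d k)" using e k by (intro mult_left_mono power_decreasing) auto
    also have "\<dots> = 2 * e * e ^ d k" by simp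
    also have "\<dots> \<le> P $$ (i, k) * e ^ d k" using le_pos[OF im k(1,2)] e by (intro mult_right_mono) auto
    also have "\<dots> \<le> (\<Sum>j<?m. P $$ (i, j) * e ^ d j)"
      using k(1) nonneg im e by (intro member_le_sum) auto
    finally have drop: "2 * e ^ d i \<le> (\<Sum>j<?m. P $$ (i, j) * e ^ d j)" .
    have "(\<Sum>j\<in>?T. P $$ (i, j) * v j) \<le> (\<Sum>j<?m. P $$ (i, j) * v j)"
      using TA nonneg im v_nonneg by (intro sum_mono2) auto
    also have "\<dots> = 1 - (\<Sum>j<?m. P $$ (i, j) * e ^ d j)"
      using row[OF im] by (simp add: v_def algebra_simps sum_subtractf)
    also have "\<dots> \<le> 1 - 2 * e ^ d i" using drop by simp
    \<comment> \<open>After expansion the claim is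
      \<open>e ^ D \<le> e ^ d i + e ^ D * e ^ d i\<close>, which follows from
      \<open>d i \<le> D\<close>.\<close>
    also have "\<dots> \<le> (1 - e ^ D) * v i"
    proof -
      have "e ^ D \<le> e ^ d i" using D[OF i] e by (intro power_decreasing) auto
      moreover have "0 \<le> e ^ D * e ^ d i" using e by simp
      ultimately show ?thesis unfolding v_def by (simp add: algebra_simps)
    qed
    finally show "(\<Sum>j\<in>?T. P $$ (i, j) * v j) \<le> (1 - e ^ D) * v i" .
  qed
qed

text \<open>In the l1-norm weighted by \<open>v\<close>, exchanging the sums over \<open>i\<close>
  and \<open>j\<close> lets \<open>contr\<close> act on the weight, so the norms satisfy
  \<open>s (Suc n) \<le> r * s n + z n\<close>. Summing over \<open>n\<close> bounds the partial
  sums of \<open>s\<close> by \<open>(s 0 + suminf z) / (1 - r)\<close>.\<close>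

lemma contracting_recursion_summable:
  fixes x y :: "nat \<Rightarrow> 'a \<Rightarrow> real" and q :: "'a \<Rightarrow> 'a \<Rightarrow> real"
  assumes fin: "finite T" and r: "r < 1" and v: "\<And>i. i \<in> T \<Longrightarrow> 0 < v i"
    and q: "\<And>i j. i \<in> T \<Longrightarrow> j \<in> T \<Longrightarrow> 0 \<le> q i j"
    and contr: "\<And>i. i \<in> T \<Longrightarrow> (\<Sum>j\<in>T. q i j * v j) \<le> r * v i"
    and rec: "\<And>n j. j \<in> T \<Longrightarrow> x (Suc n) j = (\<Sum>i\<in>T. x n i * q i j) + y n j"
    and y: "\<And>j. j \<in> T \<Longrightarrow> summable (\<lambda>n. \<bar>y n j\<bar>)"
    and j: "j \<in> T"
  shows "summable (\<lambda>n. \<bar>x n j\<bar>)"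
proof -
  define s where "s n = (\<Sum>i\<in>T. \<bar>x n i\<bar> * v i)" for n
  define z where "z n = (\<Sum>i\<in>T. \<bar>y n i\<bar> * v i)" for n
  have s_nonneg: "0 \<le> s n" for n unfolding s_def using v by (intro sum_nonneg) (simp add: less_imp_le)
  have z_nonneg: "0 \<le> z n" for n unfolding z_def using v by (intro sum_nonneg) (simp add: less_imp_le)
  have z_sum: "summable z" unfolding z_def using y by (intro summable_sum summable_mult2) auto
  have step: "s (Suc n) \<le> r * s n + z n" for n
  proof -
    have "s (Suc n) \<le> (\<Sum>j\<in>T. (\<Sum>i\<in>T. \<bar>x n i\<bar> * q i j) * v j + \<bar>y n j\<bar> * v j)"
      unfolding s_def
    proof (rule sum_mono)
      fix j assume j: "j \<in> T"
      have "\<bar>x (Suc n) j\<bar> \<le> \<bar>\<Sum>i\<in>T. x n i * q i j\<bar> + \<bar>y n j\<bar>" using rec[OF j] by simp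
      also have "\<bar>\<Sum>i\<in>T. x n i * q i j\<bar> \<le> (\<Sum>i\<in>T. \<bar>x n i * q i j\<bar>)" by (rule sum_abs)
      also have "\<dots> = (\<Sum>i\<in>T. \<bar>x n i\<bar> * q i j)" using q j by (intro sum.cong) (auto simp: abs_mult)
      finally have "\<bar>x (Suc n) j\<bar> \<le> (\<Sum>i\<in>T. \<bar>x n i\<bar> * q i j) + \<bar>y n j\<bar>" by simp
      then have "\<bar>x (Suc n) j\<bar> * v j \<le> ((\<Sum>i\<in>T. \<bar>x n i\<bar> * q i j) + \<bar>y n j\<bar>) * v j"
        using v[OF j] by (intro mult_right_mono) auto
      then show "\<bar>x (Suc n) j\<bar> * v j \<le> (\<Sum>i\<in>T. \<bar>x n i\<bar> * q i j) * v j + \<bar>y n j\<bar> * v j"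
        by (simp add: distrib_right)
    qed
    also have "\<dots> = (\<Sum>j\<in>T. \<Sum>i\<in>T. \<bar>x n i\<bar> * (q i j * v j)) + z n"
      by (simp add: sum.distrib z_def sum_distrib_right mult.assoc)
    also have "(\<Sum>j\<in>T. \<Sum>i\<in>T. \<bar>x n i\<bar> * (q i j * v j)) = (\<Sum>i\<in>T. \<bar>x n i\<bar> * (\<Sum>j\<in>T. q i j * v j))"
      by (subst sum.swap) (simp add: sum_distrib_left)
    also have "\<dots> \<le> (\<Sum>i\<in>T. \<bar>x n i\<bar> * (r * v i))"
      using contr by (intro sum_mono mult_left_mono) auto
    also have "\<dots> = r * s n" by (simp add: s_def sum_distrib_left algebra_simps)
    finally show ?thesis by simp
  qed
  \<comment> \<open>Keeping \<open>- s k\<close> on the right lets the induction close; it is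
    dropped later by nonnegativity.\<close>
  have partial: "(1 - r) * (\<Sum>n<k. s n) \<le> s 0 + (\<Sum>n<k. z n) - s k" for k
  proof (induction k)
    case (Suc k)
    then show ?case using step[of k] by (simp add: algebra_simps)
  qed simp
  have "summable s"
  proof (rule summableI_nonneg_bounded)
    show "0 \<le> s n" for n by (rule s_nonneg)
    fix k
    have "(\<Sum>n<k. z n) \<le> suminf z" using z_sum z_nonneg by (intro sum_le_suminf) auto
    then have "(1 - r) * (\<Sum>n<k. s n) \<le> s 0 + suminf z" using partial[of k] s_nonneg[of k] by linarith
    then show "(\<Sum>n<k. s n) \<le> (s 0 + suminf z) / (1 - r)" using r by (simp add: field_simps)
  qed
  then have "summable (\<lambda>n. s n / v j)" by (rule summable_divide)
  then show ?thesis
  proof (rule summable_comparison_test'[where N = 0])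
    fix n
    have "\<bar>x n j\<bar> * v j \<le> s n"
      unfolding s_def using fin j v by (intro member_le_sum) (auto simp: less_imp_le)
    then show "norm \<bar>x n j\<bar> \<le> s n / v j" using v[OF j] by (simp add: field_simps)
  qed
qed

text \<open>Summation over time turns the recursion into a linear equation for the totals; the index
  shift leaves the initial value as a source term.\<close>

lemma suminf_linear_recursion:
  fixes x y :: "nat \<Rightarrow> 'a \<Rightarrow> real"
  assumes rec: "\<And>n. x (Suc n) j = (\<Sum>i\<in>T. x n i * q i j) + y n j"
    and x: "\<And>i. i \<in> T \<Longrightarrow> summable (\<lambda>n. x n i)" and xj: "summable (\<lambda>n. x n j)"
    and y: "summable (\<lambda>n. y n j)"
  shows "(\<Sum>n. x n j) = x 0 j + (\<Sum>n. y n j) + (\<Sum>i\<in>T. (\<Sum>n. x n i) * q i j)"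
proof -
  have "(\<Sum>n. x n j) = x 0 j + (\<Sum>n. x (Suc n) j)"
    using suminf_split_head[OF xj] by simp
  also have "(\<lambda>n. x (Suc n) j) = (\<lambda>n. (\<Sum>i\<in>T. x n i * q i j) + y n j)"
    using rec by auto
  also have "suminf \<dots> = (\<Sum>n. \<Sum>i\<in>T. x n i * q i j) + (\<Sum>n. y n j)"
    using x y by (intro suminf_add[symmetric] summable_sum summable_mult2) auto
  also have "(\<Sum>n. \<Sum>i\<in>T. x n i * q i j) = (\<Sum>i\<in>T. (\<Sum>n. x n i) * q i j)"
    using x by (subst suminf_sum) (auto intro!: summable_mult2 sum.cong simp: suminf_mult2)
  finally show ?thesis by simp
qed

section \<open>Invertibility of I - Q and the fundamental matrix\<close>

text \<open>A left null vector \<open>z\<close> of I - Q is a stationary solution of the recursion x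
  (n+1) = x n Q. Contraction makes this constant sequence summable, hence \<open>z\<close> is
  zero.\<close>

lemma invertible_one_minus_contraction:
  fixes Q :: "real mat"
  assumes Q: "Q \<in> carrier_mat t t" and r: "r < 1" and v: "\<And>i. i < t \<Longrightarrow> 0 < v i"
    and nonneg: "\<And>i j. i < t \<Longrightarrow> j < t \<Longrightarrow> 0 \<le> Q $$ (i, j)"
    and contr: "\<And>i. i < t \<Longrightarrow> (\<Sum>j<t. Q $$ (i, j) * v j) \<le> r * v i"
  shows "Determinant.det (1\<^sub>m t - Q) \<noteq> 0"
proof
  let ?B = "1\<^sub>m t - Q"
  have B: "?B \<in> carrier_mat t t" using Q by (simp add: minus_carrier_mat)
  assume "Determinant.det ?B = 0"
  \<comment> \<open>Transposing yields a left null vector, as the recursion acts on row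
    vectors.\<close>
  then have "Determinant.det (transpose_mat ?B) = 0" using B by (simp add: det_transpose)
  then obtain z where z: "z \<in> carrier_vec t" "z \<noteq> 0\<^sub>v t" "transpose_mat ?B *\<^sub>v z = 0\<^sub>v t"
    using det_0_iff_vec_prod_zero[of "transpose_mat ?B" t] B by auto
  have fixed: "z $ j = (\<Sum>i<t. z $ i * Q $$ (i, j))" if "j < t" for j
  proof -
    have "0 = (transpose_mat ?B *\<^sub>v z) $ j" using z(3) that by simp
    also have "\<dots> = (\<Sum>i<t. ((if i = j then 1 else 0) - Q $$ (i, j)) * z $ i)"
      using that Q z(1) by (auto simp: scalar_prod_def lessThan_atLeast0 intro!: sum.cong)
    also have "\<dots> = (\<Sum>i<t. (if i = j then z $ i else 0) - z $ i * Q $$ (i, j))"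
      by (intro sum.cong) (auto simp: algebra_simps)
    also have "\<dots> = z $ j - (\<Sum>i<t. z $ i * Q $$ (i, j))"
      using that by (simp add: sum_subtractf)
    finally show ?thesis by simp
  qed
  have "z $ j = 0" if "j < t" for j
  proof -
    have "summable (\<lambda>n::nat. \<bar>z $ j\<bar>)"
    proof (rule contracting_recursion_summable[where T = "{..<t}" and v = v and r = r
          and q = "\<lambda>i j. Q $$ (i, j)" and x = "\<lambda>n j. z $ j" and y = "\<lambda>n j. 0"])
      show "z $ j = (\<Sum>i<t. z $ i * Q $$ (i, j)) + 0" if "j \<in> {..<t}" for n :: nat and j
        using fixed[of j] that by simp
    qed (use r v nonneg contr that in auto)
    then show ?thesis by (simp add: summable_const_iff)
  qed
  then show False using z by (auto intro!: eq_vecI)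
qed

text \<open>A nonzero determinant rules out \<open>None\<close> as the result of
  \<open>mat_inverse\<close>, so the \<open>the\<close> in \<open>fundamental_matrix\<close> selects
  a genuine inverse.\<close>

lemma fundamental_matrix_inverse:
  assumes Q: "Q \<in> carrier_mat t t" and det: "Determinant.det (1\<^sub>m t - Q) \<noteq> 0"
  shows "invertible_mat (1\<^sub>m t - Q)" and "fundamental_matrix Q \<in> carrier_mat t t"
    and "(1\<^sub>m t - Q) * fundamental_matrix Q = 1\<^sub>m t"
proof -
  let ?B = "1\<^sub>m t - Q"
  have B: "?B \<in> carrier_mat t t" using Q by (simp add: minus_carrier_mat)
  have "mat_inverse ?B \<noteq> None"
    using mat_inverse(1)[OF B] det_non_zero_imp_unit[OF B det] by fastforce
  then obtain N where "mat_inverse ?B = Some N" by auto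
  moreover from mat_inverse(2)[OF B this] have "?B * N = 1\<^sub>m t" "N * ?B = 1\<^sub>m t" "N \<in> carrier_mat t t"
    by auto
  moreover have "dim_row Q = t" using Q by simp
  ultimately show "fundamental_matrix Q \<in> carrier_mat t t" "?B * fundamental_matrix Q = 1\<^sub>m t"
    "invertible_mat ?B"
    using B by (auto simp: fundamental_matrix_def invertible_mat_def inverts_mat_def)
qed

text \<open>The equation reads x (I - Q) = e for row vectors; multiplying by the inverse from the
  right solves it. This identifies the time totals of both masses.\<close>

lemma fundamental_matrix_solution:
  assumes Q: "Q \<in> carrier_mat t t" and det: "Determinant.det (1\<^sub>m t - Q) \<noteq> 0"
    and eq: "\<And>j. j < t \<Longrightarrow> x j = e j + (\<Sum>i<t. x i * Q $$ (i, j))" and j: "j < t"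
  shows "x j = (\<Sum>i<t. e i * fundamental_matrix Q $$ (i, j))"
proof -
  let ?B = "1\<^sub>m t - Q" and ?N = "fundamental_matrix Q"
  \<comment> \<open>Row vectors are encoded as matrices with one row, so that associativity of the
    matrix product applies.\<close>
  define X where "X = Matrix.mat 1 t (\<lambda>(_, j). x j)"
  define E where "E = Matrix.mat 1 t (\<lambda>(_, j). e j)"
  have B: "?B \<in> carrier_mat t t" using Q by (simp add: minus_carrier_mat)
  note N = fundamental_matrix_inverse(2)[OF Q det]
  have X: "X \<in> carrier_mat 1 t" by (simp add: X_def)
  have "X * ?B = E"
  proof (rule eq_matI)
    fix k j assume kj: "k < dim_row E" "j < dim_col E"
    then have j: "k = 0" "j < t" by (auto simp: E_def)
    have "(X * ?B) $$ (k, j) = (\<Sum>i<t. x i * ((if i = j then 1 else 0) - Q $$ (i, j)))"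
      using j Q by (auto simp: X_def scalar_prod_def lessThan_atLeast0 intro!: sum.cong)
    also have "\<dots> = (\<Sum>i<t. (if i = j then x i else 0) - x i * Q $$ (i, j))"
      by (intro sum.cong) (auto simp: algebra_simps)
    also have "\<dots> = x j - (\<Sum>i<t. x i * Q $$ (i, j))"
      using j by (simp add: sum_subtractf)
    finally show "(X * ?B) $$ (k, j) = E $$ (k, j)" using eq[OF j(2)] j by (simp add: E_def)
  qed (use Q in \<open>auto simp: X_def E_def\<close>)
  then have "X = E * ?N"
    using assoc_mult_mat[OF X B N] fundamental_matrix_inverse(3)[OF Q det] right_mult_one_mat[OF X]
    by simp
  then have "X $$ (0, j) = (E * ?N) $$ (0, j)" by (rule arg_cong)
  moreover have "X $$ (0, j) = x j" using j by (simp add: X_def)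
  ultimately have "x j = (E * ?N) $$ (0, j)" by simp
  also have "\<dots> = (\<Sum>i<t. e i * ?N $$ (i, j))"
    using j N by (auto simp: E_def scalar_prod_def lessThan_atLeast0 intro!: sum.cong)
  finally show ?thesis .
qed

section \<open>The Markov property on finite histories\<close>

text \<open>Truncation by \<open>restrict\<close> gives the path up to time \<open>n\<close> only
  finitely many values, so expectations of its functions become finite sums.\<close>

abbreviation history :: "(nat \<Rightarrow> 'w \<Rightarrow> nat) \<Rightarrow> nat \<Rightarrow> 'w \<Rightarrow> nat \<Rightarrow> nat" where
  "history S n \<omega> \<equiv> restrict (\<lambda>k. S k \<omega>) {..n}"

lemma history_eq_iff:
  assumes "x \<in> PiE {..n} A"
  shows "history S n \<omega> = x \<longleftrightarrow> (\<forall>k\<le>n. S k \<omega> = x k)"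
  using assms by (force simp: PiE_def extensional_def fun_eq_iff restrict_def)

locale markov =
  fixes M :: "'w measure" and S :: "nat \<Rightarrow> 'w \<Rightarrow> nat" and P :: "real mat"
  assumes mc: "markov_chain M S P"
begin

sublocale prob_space M using mc by (simp add: markov_chain_def)

lemma S_measurable: "S n \<in> measurable M (count_space {..<dim_row P})"
  using mc by (simp add: markov_chain_def)

lemma S_less: "\<omega> \<in> space M \<Longrightarrow> S n \<omega> < dim_row P"
  using measurable_space[OF S_measurable] by fastforce

lemma S_event [measurable]: "{\<omega> \<in> space M. S n \<omega> = j} \<in> sets M"
proof (cases "j < dim_row P")
  case True
  then show ?thesis
    using measurable_sets[OF S_measurable, of "{j}" n] by (simp add: vimage_def Int_def conj_commute)
next
  case False
  then have "{\<omega> \<in> space M. S n \<omega> = j} = {}" using S_less by fastforce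
  then show ?thesis by (metis sets.empty_sets)
qed

abbreviation histories :: "nat \<Rightarrow> (nat \<Rightarrow> nat) set" where
  "histories n \<equiv> PiE {..n} (\<lambda>_. {..<dim_row P})"

lemma history_in: "\<omega> \<in> space M \<Longrightarrow> history S n \<omega> \<in> histories n"
  using S_less by auto

lemma finite_histories: "finite (histories n)"
  by (intro finite_PiE) auto

lemma path_event [measurable]: "{\<omega> \<in> space M. \<forall>k\<le>n. S k \<omega> = x k} \<in> sets M"
  by measurable

lemma history_event: "{\<omega> \<in> space M. history S n \<omega> = x} \<in> sets M"
proof (cases "x \<in> histories n")
  case True
  then show ?thesis by (simp only: history_eq_iff) measurable
next
  case False
  then have "{\<omega> \<in> space M. history S n \<omega> = x} = {}" using history_in by blast
  then show ?thesis by (metis sets.empty_sets)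
qed

lemma history_measurable: "history S n \<in> measurable M (count_space (histories n))"
proof -
  have "history S n -` {x} \<inter> space M \<in> sets M" for x
    using history_event[of n x] by (simp add: vimage_def Int_def conj_commute)
  then show ?thesis
    using history_in by (subst measurable_count_space_eq2[OF finite_histories]) blast
qed

text \<open>The sum of \<open>norm (g x)\<close> over the finitely many histories is a constant
  bound.\<close>

lemma integrable_history:
  fixes g :: "(nat \<Rightarrow> nat) \<Rightarrow> real"
  shows "integrable M (\<lambda>\<omega>. g (history S n \<omega>))"
proof (rule integrable_const_bound)
  have "norm (g (history S n \<omega>)) \<le> (\<Sum>x\<in>histories n. norm (g x))" if "\<omega> \<in> space M" for \<omega>
    by (intro member_le_sum history_in[OF that] finite_histories norm_ge_zero)
  then show "AE \<omega> in M. norm (g (history S n \<omega>)) \<le> (\<Sum>x\<in>histories n. norm (g x))" by simp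
  have "g \<in> measurable (count_space (histories n)) borel" by simp
  from measurable_compose[OF history_measurable this]
  show "(\<lambda>\<omega>. g (history S n \<omega>)) \<in> borel_measurable M" .
qed

lemma integrable_historyI:
  fixes f :: "'w \<Rightarrow> real"
  assumes "\<And>\<omega>. f \<omega> = g (history S n \<omega>)"
  shows "integrable M f"
  using integrable_history[of g n] by (simp flip: assms)

text \<open>The product form also covers null histories, about which the transition law is silent:
  there both sides are 0.\<close>

lemma path_prob_Suc:
  assumes "j < dim_row P"
  shows "\<P>(\<omega> in M. (\<forall>k\<le>n. S k \<omega> = x k) \<and> S (Suc n) \<omega> = j)
       = \<P>(\<omega> in M. \<forall>k\<le>n. S k \<omega> = x k) * P $$ (x n, j)" (is "?joint = ?path * _")
proof (cases "?path = 0")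
  case True
  have "?joint \<le> ?path" by (intro finite_measure_mono) auto
  with True have "?joint = 0" by (simp add: measure_le_0_iff)
  with True show ?thesis by simp
next
  case False
  then have "?path > 0" by (simp add: zero_less_measure_iff)
  then have "\<P>(\<omega> in M. S (Suc n) \<omega> = j \<bar> \<forall>k\<le>n. S k \<omega> = x k) = P $$ (x n, j)"
    using mc assms by (auto simp: markov_chain_def)
  then show ?thesis using False by (simp add: cond_prob_def field_simps conj_commute)
qed

text \<open>The Markov property in integrated form: under a function of the past, the indicator of
  the next state may be replaced by its transition probability. Decomposing over histories reduces
  this to \<open>path_prob_Suc\<close>.\<close>

lemma expectation_next_state:
  fixes g :: "(nat \<Rightarrow> nat) \<Rightarrow> real"
  assumes j: "j < dim_row P"
  shows "expectation (\<lambda>\<omega>. g (history S n \<omega>) * of_bool (S (Suc n) \<omega> = j))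
       = expectation (\<lambda>\<omega>. g (history S n \<omega>) * P $$ (S n \<omega>, j))"
proof -
  let ?A = "\<lambda>x. {\<omega> \<in> space M. \<forall>k\<le>n. S k \<omega> = x k}"
  let ?J = "{\<omega> \<in> space M. S (Suc n) \<omega> = j}"
  \<comment> \<open>Exactly one of the events \<open>?A x\<close> contains a given \<omega>, namely
    that of its own history.\<close>
  have split: "h (history S n \<omega>) = (\<Sum>x\<in>histories n. h x * indicator (?A x) \<omega>)"
    if "\<omega> \<in> space M" for \<omega> and h :: "(nat \<Rightarrow> nat) \<Rightarrow> real"
  proof -
    have "(\<Sum>x\<in>histories n. h x * indicator (?A x) \<omega>)
        = (\<Sum>x\<in>histories n. if x = history S n \<omega> then h x else 0)"
      using that by (intro sum.cong) (auto simp: indicator_def history_eq_iff[symmetric])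
    then show ?thesis using history_in[OF that] finite_histories by simp
  qed
  have "expectation (\<lambda>\<omega>. g (history S n \<omega>) * of_bool (S (Suc n) \<omega> = j))
      = expectation (\<lambda>\<omega>. \<Sum>x\<in>histories n. g x * indicator (?A x \<inter> ?J) \<omega>)"
    by (intro Bochner_Integration.integral_cong)
      (auto simp: split[of _ g] sum_distrib_right indicator_def intro!: sum.cong)
  also have "\<dots> = (\<Sum>x\<in>histories n. g x * prob (?A x \<inter> ?J))"
    by (subst Bochner_Integration.integral_sum) (auto simp: less_top[symmetric])
  also have "\<dots> = (\<Sum>x\<in>histories n. g x * P $$ (x n, j) * prob (?A x))"
  proof (intro sum.cong refl)
    fix x
    have "?A x \<inter> ?J = {\<omega> \<in> space M. (\<forall>k\<le>n. S k \<omega> = x k) \<and> S (Suc n) \<omega> = j}" by auto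
    then show "g x * prob (?A x \<inter> ?J) = g x * P $$ (x n, j) * prob (?A x)"
      using path_prob_Suc[OF j, of n x] by simp
  qed
  also have "\<dots> = expectation (\<lambda>\<omega>. \<Sum>x\<in>histories n. g x * P $$ (x n, j) * indicator (?A x) \<omega>)"
    by (subst Bochner_Integration.integral_sum) (auto simp: less_top[symmetric])
  also have "\<dots> = expectation (\<lambda>\<omega>. g (history S n \<omega>) * P $$ (S n \<omega>, j))"
    using split[of _ "\<lambda>x. g x * P $$ (x n, j)"]
    by (intro Bochner_Integration.integral_cong) auto
  finally show ?thesis .
qed

section \<open>Recursions for the state and reward masses\<close>

text \<open>
  Restricting to events instead of conditioning on them keeps the recursions below linear and free
  of null-event cases.
\<close>

definition state_mass :: "nat \<Rightarrow> nat \<Rightarrow> nat \<Rightarrow> real" where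
  "state_mass i n j = expectation (\<lambda>\<omega>. of_bool (S 0 \<omega> = i) * of_bool (S n \<omega> = j))"

definition reward_mass :: "real mat \<Rightarrow> nat \<Rightarrow> nat \<Rightarrow> nat \<Rightarrow> real" where
  "reward_mass \<Theta> i n j =
     expectation (\<lambda>\<omega>. accumulated_reward \<Theta> S n \<omega> * of_bool (S 0 \<omega> = i) * of_bool (S n \<omega> = j))"

text \<open>The coordinate process \<open>\<lambda>k x. x k\<close> computes the reward from the
  path itself, so the results on functions of the history apply to it.\<close>

lemma accumulated_reward_history:
  "accumulated_reward \<Theta> S n \<omega> = accumulated_reward \<Theta> (\<lambda>k x. x k) n (history S n \<omega>)"
  by (auto simp: accumulated_reward_def intro!: sum.cong)

lemma accumulated_reward_Suc:
  "accumulated_reward \<Theta> S (Suc n) \<omega> = accumulated_reward \<Theta> S n \<omega> + \<Theta> $$ (S n \<omega>, S (Suc n) \<omega>)"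
  by (simp add: accumulated_reward_def)

lemma sum_states:
  fixes c :: real
  assumes "\<omega> \<in> space M"
  shows "(\<Sum>l<dim_row P. c * of_bool (S n \<omega> = l) * f l) = c * f (S n \<omega>)"
proof -
  have "(\<Sum>l<dim_row P. c * of_bool (S n \<omega> = l) * f l) = (\<Sum>l<dim_row P. if l = S n \<omega> then c * f l else 0)"
    by (intro sum.cong) auto
  then show ?thesis using S_less[OF assms, of n] by simp
qed

text \<open>Splitting by the state at time \<open>n\<close> turns \<open>f (S n \<omega>)\<close>
  into a coefficient; this is the source of the matrix products in the recursions.\<close>

lemma expectation_split_state:
  fixes g :: "(nat \<Rightarrow> nat) \<Rightarrow> real"
  shows "expectation (\<lambda>\<omega>. g (history S n \<omega>) * f (S n \<omega>))
       = (\<Sum>l<dim_row P. expectation (\<lambda>\<omega>. g (history S n \<omega>) * of_bool (S n \<omega> = l)) * f l)"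
proof -
  have int: "integrable M (\<lambda>\<omega>. g (history S n \<omega>) * of_bool (S n \<omega> = l))" for l
    by (rule integrable_historyI[of _ "\<lambda>x. g x * of_bool (x n = l)" n]) simp
  have "expectation (\<lambda>\<omega>. g (history S n \<omega>) * f (S n \<omega>))
      = expectation (\<lambda>\<omega>. \<Sum>l<dim_row P. g (history S n \<omega>) * of_bool (S n \<omega> = l) * f l)"
    by (intro Bochner_Integration.integral_cong) (simp_all add: sum_states)
  then show ?thesis using int by (simp add: Bochner_Integration.integral_sum)
qed

lemma state_mass_0: "state_mass i 0 j = (if j = i then prob {\<omega> \<in> space M. S 0 \<omega> = i} else 0)"
proof (cases "j = i")
  case True
  have "state_mass i 0 i = expectation (indicator {\<omega> \<in> space M. S 0 \<omega> = i})"
    unfolding state_mass_def by (intro Bochner_Integration.integral_cong) (auto simp: indicator_def)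
  then show ?thesis using True by simp
next
  case False
  then have "state_mass i 0 j = expectation (\<lambda>_. 0)"
    unfolding state_mass_def by (intro Bochner_Integration.integral_cong) auto
  then show ?thesis using False by simp
qed

lemma reward_mass_0: "reward_mass \<Theta> i 0 j = 0"
  by (simp add: reward_mass_def accumulated_reward_def)

lemma state_mass_Suc:
  assumes "j < dim_row P"
  shows "state_mass i (Suc n) j = (\<Sum>l<dim_row P. state_mass i n l * P $$ (l, j))"
  unfolding state_mass_def
  using expectation_next_state[OF assms, of "\<lambda>x. of_bool (x 0 = i)" n]
    expectation_split_state[of "\<lambda>x. of_bool (x 0 = i)" n "\<lambda>l. P $$ (l, j)"]
  by simp

text \<open>On the event that the next state is \<open>j\<close>, the newest reward is
  \<open>\<Theta> $$ (S n \<omega>, j)\<close>, a function of the history up to \<open>n\<close>.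
  Hence \<open>expectation_next_state\<close> applies to old and new reward together, and linearity
  separates them.\<close>

lemma reward_mass_Suc:
  assumes j: "j < dim_row P"
  shows "reward_mass \<Theta> i (Suc n) j = (\<Sum>l<dim_row P. reward_mass \<Theta> i n l * P $$ (l, j))
           + (\<Sum>l<dim_row P. state_mass i n l * (\<Theta> $$ (l, j) * P $$ (l, j)))"
proof -
  let ?r = "\<lambda>x. accumulated_reward \<Theta> (\<lambda>k x. x k) n x" and ?b = "\<lambda>x. of_bool (x 0 = i) :: real"
  let ?g = "\<lambda>x. (?r x + \<Theta> $$ (x n, j)) * ?b x"
  have int: "integrable M (\<lambda>\<omega>. ?r (history S n \<omega>) * ?b (history S n \<omega>) * P $$ (S n \<omega>, j))"
    "integrable M (\<lambda>\<omega>. ?b (history S n \<omega>) * (\<Theta> $$ (S n \<omega>, j) * P $$ (S n \<omega>, j)))"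
    by (rule integrable_historyI[of _ "\<lambda>x. ?r x * ?b x * P $$ (x n, j)" n], simp)
      (rule integrable_historyI[of _ "\<lambda>x. ?b x * (\<Theta> $$ (x n, j) * P $$ (x n, j))" n], simp)
  have "reward_mass \<Theta> i (Suc n) j
      = expectation (\<lambda>\<omega>. ?g (history S n \<omega>) * of_bool (S (Suc n) \<omega> = j))"
    unfolding reward_mass_def
    by (intro Bochner_Integration.integral_cong)
      (auto simp: accumulated_reward_Suc simp flip: accumulated_reward_history)
  also have "\<dots> = expectation (\<lambda>\<omega>. ?g (history S n \<omega>) * P $$ (S n \<omega>, j))"
    by (rule expectation_next_state[OF j])
  also have "\<dots> = expectation (\<lambda>\<omega>. ?r (history S n \<omega>) * ?b (history S n \<omega>) * P $$ (S n \<omega>, j)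
      + ?b (history S n \<omega>) * (\<Theta> $$ (S n \<omega>, j) * P $$ (S n \<omega>, j)))"
    by (intro Bochner_Integration.integral_cong) (auto simp: algebra_simps)
  also have "\<dots> = expectation (\<lambda>\<omega>. ?r (history S n \<omega>) * ?b (history S n \<omega>) * P $$ (S n \<omega>, j))
      + expectation (\<lambda>\<omega>. ?b (history S n \<omega>) * (\<Theta> $$ (S n \<omega>, j) * P $$ (S n \<omega>, j)))"
    by (rule Bochner_Integration.integral_add[OF int])
  also have "expectation (\<lambda>\<omega>. ?r (history S n \<omega>) * ?b (history S n \<omega>) * P $$ (S n \<omega>, j))
      = (\<Sum>l<dim_row P. reward_mass \<Theta> i n l * P $$ (l, j))"
    using expectation_split_state[of "\<lambda>x. ?r x * ?b x" n "\<lambda>l. P $$ (l, j)"]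
    by (simp add: reward_mass_def flip: accumulated_reward_history)
  also have "expectation (\<lambda>\<omega>. ?b (history S n \<omega>) * (\<Theta> $$ (S n \<omega>, j) * P $$ (S n \<omega>, j)))
      = (\<Sum>l<dim_row P. state_mass i n l * (\<Theta> $$ (l, j) * P $$ (l, j)))"
    using expectation_split_state[of ?b n "\<lambda>l. \<Theta> $$ (l, j) * P $$ (l, j)"]
    by (simp add: state_mass_def)
  finally show ?thesis .
qed

section \<open>From masses to conditional expectations\<close>

lemma expected_reward_eq:
  "expected_reward M S \<Theta> n i
     = (\<Sum>j<dim_row P. reward_mass \<Theta> i n j) / prob {\<omega> \<in> space M. S 0 \<omega> = i}"
proof -
  let ?g = "\<lambda>x. accumulated_reward \<Theta> (\<lambda>k x. x k) n x * of_bool (x 0 = i)"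
  have "expectation (\<lambda>\<omega>. accumulated_reward \<Theta> S n \<omega> * indicator {\<omega> \<in> space M. S 0 \<omega> = i} \<omega>)
      = expectation (\<lambda>\<omega>. ?g (history S n \<omega>) * 1)"
    by (intro Bochner_Integration.integral_cong)
      (auto simp: indicator_def simp flip: accumulated_reward_history)
  also have "\<dots> = (\<Sum>j<dim_row P. reward_mass \<Theta> i n j)"
    using expectation_split_state[of ?g n "\<lambda>_. 1"]
    by (simp add: reward_mass_def flip: accumulated_reward_history)
  finally show ?thesis by (simp add: expected_reward_def cond_expectation_def)
qed

text \<open>The probability of the joint event cancels between \<open>R_bar\<close> and the
  transition probability. If it is 0, the reward mass is an integral over a null event, in agreement
  with the value 0 prescribed in \<open>R_hat\<close>.\<close>

lemma R_hat_eq: "R_hat M S \<Theta> n i j = reward_mass \<Theta> i n j / prob {\<omega> \<in> space M. S 0 \<omega> = i}"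
proof -
  let ?c = "prob {\<omega> \<in> space M. S 0 \<omega> = i}"
  let ?B = "{\<omega> \<in> space M. S 0 \<omega> = i \<and> S n \<omega> = j}"
  have B: "?B \<in> sets M" by measurable
  have mass: "reward_mass \<Theta> i n j = expectation (\<lambda>\<omega>. accumulated_reward \<Theta> S n \<omega> * indicator ?B \<omega>)"
    unfolding reward_mass_def
    by (intro Bochner_Integration.integral_cong) (auto simp: indicator_def)
  have p: "\<P>(\<omega> in M. S n \<omega> = j \<bar> S 0 \<omega> = i) = prob ?B / ?c"
    by (simp add: cond_prob_def conj_commute)
  show ?thesis
  proof (cases "prob ?B = 0")
    case True
    then have "AE \<omega> in M. \<omega> \<notin> ?B" using B by (simp add: prob_eq_0)
    then have "AE \<omega> in M. accumulated_reward \<Theta> S n \<omega> * indicator ?B \<omega> = 0"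
      by eventually_elim (simp add: indicator_def)
    then have "reward_mass \<Theta> i n j = 0"
      unfolding mass by (rule integral_eq_zero_AE)
    then show ?thesis using True by (simp add: R_hat_def p)
  next
    case False
    then show ?thesis by (simp add: R_hat_def p R_bar_def cond_expectation_def mass)
  qed
qed

end

section \<open>Matrix entries and series\<close>

lemma index_mult_mat_sum:
  fixes A B :: "'a::semiring_0 mat"
  assumes "A \<in> carrier_mat n k" "B \<in> carrier_mat k m" "i < n" "j < m"
  shows "(A * B) $$ (i, j) = (\<Sum>l<k. A $$ (i, l) * B $$ (l, j))"
  using assms by (auto simp: scalar_prod_def lessThan_atLeast0 intro!: sum.cong)

text \<open>Provides the absolute summability of the source term u n H1 in the recursion of the
  reward mass.\<close>

lemma summable_abs_linear_combination:
  fixes x :: "nat \<Rightarrow> 'a \<Rightarrow> real"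
  assumes "\<And>i. i \<in> T \<Longrightarrow> summable (\<lambda>n. \<bar>x n i\<bar>)"
  shows "summable (\<lambda>n. \<bar>\<Sum>i\<in>T. x n i * b i\<bar>)"
proof (rule summable_comparison_test'[where N = 0])
  show "summable (\<lambda>n. \<Sum>i\<in>T. \<bar>x n i\<bar> * \<bar>b i\<bar>)"
    using assms by (intro summable_sum summable_mult2) auto
  show "norm \<bar>\<Sum>i\<in>T. x n i * b i\<bar> \<le> (\<Sum>i\<in>T. \<bar>x n i\<bar> * \<bar>b i\<bar>)" for n
    using sum_abs[of "\<lambda>i. x n i * b i" T] by (simp add: abs_mult)
qed

lemma increment_tendsto:
  fixes f b :: "nat \<Rightarrow> real"
  assumes "\<And>n. f (Suc n) = f n + b n" and "summable b"
  shows "f \<longlonglongrightarrow> f 0 + suminf b"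
proof -
  have "f = (\<lambda>n. f 0 + (\<Sum>k<n. b k))"
  proof
    show "f n = f 0 + (\<Sum>k<n. b k)" for n by (induction n) (simp_all add: assms(1))
  qed
  moreover have "(\<lambda>n. f 0 + (\<Sum>k<n. b k)) \<longlonglongrightarrow> f 0 + suminf b"
    using assms(2) by (intro tendsto_add tendsto_const summable_LIMSEQ)
  ultimately show ?thesis by simp
qed

section \<open>Entrywise limits and the total reward\<close>

text \<open>Convergence is asserted explicitly because \<open>lim\<close> says nothing about a
  divergent sequence. The initial law is arbitrary, so the claims concern initial states of positive
  probability. The block shape alone would admit an absorbing state among the first
  \<open>t\<close>; the condition on \<open>transient_states P\<close> excludes this.\<close>

theorem corollary4:
  fixes M :: "'w measure" and S :: "nat \<Rightarrow> 'w \<Rightarrow> nat"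
    and P Q R \<Theta> \<Theta>\<^sub>1 \<Theta>\<^sub>2 H\<^sub>1 H\<^sub>2 N :: "real mat"
    and t a :: nat
  assumes chain: "markov_chain M S P"
    and absorbing: "absorbing_chain P"
    and transient: "transient_states P = {..<t}"
    and Q: "Q \<in> carrier_mat t t" and R: "R \<in> carrier_mat t a"
    and P: "P = four_block_mat Q R (0\<^sub>m a t) (1\<^sub>m a)"
    and \<Theta>1: "\<Theta>\<^sub>1 \<in> carrier_mat t t" and \<Theta>2: "\<Theta>\<^sub>2 \<in> carrier_mat t a"
    and \<Theta>: "\<Theta> = four_block_mat \<Theta>\<^sub>1 \<Theta>\<^sub>2 (0\<^sub>m a t) (0\<^sub>m a a)"
    and H1: "H\<^sub>1 \<in> carrier_mat t t" and H2: "H\<^sub>2 \<in> carrier_mat t a"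
    and H: "hadamard_prod \<Theta> P = four_block_mat H\<^sub>1 H\<^sub>2 (0\<^sub>m a t) (0\<^sub>m a a)"
    and N: "N = fundamental_matrix Q"
  shows "invertible_mat (1\<^sub>m t - Q) \<and>
    (\<forall>i<t + a. \<P>(\<omega> in M. S 0 \<omega> = i) > 0 \<longrightarrow>
       convergent (\<lambda>n. expected_reward M S \<Theta> n i) \<and>
       R_bar_inf M S \<Theta> i = (\<Sum>j<t + a. R_hat_inf M S \<Theta> i j) \<and>
       (\<forall>j<t + a.
          convergent (\<lambda>n. R_hat M S \<Theta> n i j) \<and>
          R_hat_inf M S \<Theta> i j =
            four_block_mat (0\<^sub>m t t) (N * (H\<^sub>2 + H\<^sub>1 * N * R)) (0\<^sub>m a t) (0\<^sub>m a a) $$ (i, j)))"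
proof -
  interpret markov M S P by unfold_locales (rule chain)
  have stoch: "stochastic_mat P" using chain by (simp add: markov_chain_def)
  have dim [simp]: "dim_row P = t + a" "dim_col P = t + a" using Q R by (simp_all add: P)
  have PQ: "P $$ (i, j) = Q $$ (i, j)" if "i < t" "j < t" for i j
    using that Q R by (simp add: P)
  have PR: "P $$ (i, t + k) = R $$ (i, k)" if "i < t" "k < a" for i k
    using that Q R by (simp add: P)
  have P0: "P $$ (l, j) = 0" if "\<not> l < t" "l < t + a" "j < t" for l j
    using that Q R by (auto simp: P)
  have PI: "P $$ (l, t + k) = (if l = t + k then 1 else 0)" if "\<not> l < t" "l < t + a" "k < a" for l k
    using that Q R by (auto simp: P)
  \<comment> \<open>The entries of the Hadamard product in the form in which
    \<open>reward_mass_Suc\<close> yields them.\<close>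
  define G where "G l j = \<Theta> $$ (l, j) * P $$ (l, j)" for l j
  have G: "G l j = four_block_mat H\<^sub>1 H\<^sub>2 (0\<^sub>m a t) (0\<^sub>m a a) $$ (l, j)" if "l < t + a" "j < t + a" for l j
    using that \<Theta>1 \<Theta>2 unfolding H[symmetric] by (simp add: hadamard_prod_def G_def \<Theta>)
  have GH1: "G l j = H\<^sub>1 $$ (l, j)" if "l < t" "j < t" for l j
    using that H1 H2 by (simp add: G)
  have GH2: "G l (t + k) = H\<^sub>2 $$ (l, k)" if "l < t" "k < a" for l k
    using that H1 H2 by (simp add: G)
  have G0: "G l j = 0" if "\<not> l < t" "l < t + a" "j < t + a" for l j
    using that H1 H2 by (auto simp: G)

  obtain v r where r: "r < (1::real)" and v: "\<And>i. i < t \<Longrightarrow> 0 < v i"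
    and contr: "\<And>i. i < t \<Longrightarrow> (\<Sum>j<t. P $$ (i, j) * v j) \<le> r * v i"
    using absorbing_chain_weight[OF stoch absorbing] unfolding transient by (metis lessThan_iff)
  have contrQ: "(\<Sum>j<t. Q $$ (i, j) * v j) \<le> r * v i" if "i < t" for i
    using contr[OF that] that by (simp add: PQ)
  have Q_nonneg: "0 \<le> Q $$ (i, j)" if "i < t" "j < t" for i j
    using stoch that by (simp add: stochastic_mat_def flip: PQ)
  have det: "Determinant.det (1\<^sub>m t - Q) \<noteq> 0"
    by (rule invertible_one_minus_contraction[OF Q r v Q_nonneg contrQ])
  have N_carrier: "N \<in> carrier_mat t t" unfolding N by (rule fundamental_matrix_inverse(2)[OF Q det])
  let ?F = "four_block_mat (0\<^sub>m t t) (N * (H\<^sub>2 + H\<^sub>1 * N * R)) (0\<^sub>m a t) (0\<^sub>m a a)"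

  \<comment> \<open>These entrywise limits are the core; the total reward is a finite sum over
    \<open>j\<close>.\<close>
  have limit: "(\<lambda>n. R_hat M S \<Theta> n i j) \<longlonglongrightarrow> ?F $$ (i, j)"
    if i: "i < t + a" and c_pos: "prob {\<omega> \<in> space M. S 0 \<omega> = i} > 0" and j: "j < t + a" for i j
  proof -
    define c where "c = prob {\<omega> \<in> space M. S 0 \<omega> = i}"
    define u where "u = state_mass i"
    define w where "w = reward_mass \<Theta> i"
    \<comment> \<open>Absorbing states send no mass back, so the recursion closes on the transient
      states.\<close>
    have u_rec: "u (Suc n) j = (\<Sum>l<t. u n l * Q $$ (l, j))" if "j < t" for n j
    proof -
      have "u (Suc n) j = (\<Sum>l<t + a. u n l * P $$ (l, j))"
        using that unfolding u_def by (subst state_mass_Suc) simp_all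
      also have "\<dots> = (\<Sum>l<t. u n l * P $$ (l, j))"
        using that P0 by (intro sum.mono_neutral_right) auto
      finally show ?thesis using that by (simp add: PQ)
    qed
    have w_Suc: "w (Suc n) j = (\<Sum>l<t + a. w n l * P $$ (l, j)) + (\<Sum>l<t. u n l * G l j)"
      if "j < t + a" for n j
    proof -
      have "(\<Sum>l<t + a. u n l * G l j) = (\<Sum>l<t. u n l * G l j)"
        using that G0 by (intro sum.mono_neutral_right) auto
      then show ?thesis
        using that unfolding u_def w_def G_def by (subst reward_mass_Suc) simp_all
    qed
    have w_rec: "w (Suc n) j = (\<Sum>l<t. w n l * Q $$ (l, j)) + (\<Sum>l<t. u n l * H\<^sub>1 $$ (l, j))"
      if "j < t" for n j
    proof -
      have "(\<Sum>l<t + a. w n l * P $$ (l, j)) = (\<Sum>l<t. w n l * P $$ (l, j))"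
        using that P0 by (intro sum.mono_neutral_right) auto
      then show ?thesis using that by (simp add: w_Suc PQ GH1)
    qed
    \<comment> \<open>An absorbing state keeps its own mass and receives none from other absorbing
      states, so its recursion is a pure increment.\<close>
    have w_abs: "w (Suc n) (t + k) = w n (t + k)
        + ((\<Sum>l<t. w n l * R $$ (l, k)) + (\<Sum>l<t. u n l * H\<^sub>2 $$ (l, k)))" if k: "k < a" for n k
    proof -
      have "(\<Sum>l<t + a. w n l * P $$ (l, t + k)) = (\<Sum>l\<in>insert (t + k) {..<t}. w n l * P $$ (l, t + k))"
        using k PI by (intro sum.mono_neutral_right) auto
      also have "\<dots> = w n (t + k) + (\<Sum>l<t. w n l * P $$ (l, t + k))"
        using k by (simp add: PI)
      finally show ?thesis using k by (simp add: w_Suc PR GH2)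
    qed

    have u_abs: "summable (\<lambda>n. \<bar>u n j\<bar>)" if "j < t" for j
      by (rule contracting_recursion_summable[where T = "{..<t}" and v = v and r = r
            and q = "\<lambda>i j. Q $$ (i, j)" and y = "\<lambda>n j. 0"])
        (use r v Q_nonneg contrQ u_rec that in auto)
    \<comment> \<open>The source term is a combination of the state masses, whose absolute
      summability is already known.\<close>
    have w_abs_sum: "summable (\<lambda>n. \<bar>w n j\<bar>)" if "j < t" for j
      by (rule contracting_recursion_summable[where T = "{..<t}" and v = v and r = r
            and q = "\<lambda>i j. Q $$ (i, j)" and y = "\<lambda>n j. \<Sum>l<t. u n l * H\<^sub>1 $$ (l, j)"])
        (use r v Q_nonneg contrQ w_rec u_abs that in \<open>auto intro!: summable_abs_linear_combination\<close>)
    have u_sum: "summable (\<lambda>n. u n l)" if "l < t" for l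
      using u_abs[OF that] by (rule summable_rabs_cancel)
    have w_sum: "summable (\<lambda>n. w n l)" if "l < t" for l
      using w_abs_sum[OF that] by (rule summable_rabs_cancel)
    \<comment> \<open>For transient \<open>l\<close>, \<open>U l\<close> is the expected number of
      visits to \<open>l\<close> on the event that the chain starts in \<open>i\<close>.\<close>
    define U where "U l = (\<Sum>n. u n l)" for l
    define W where "W l = (\<Sum>n. w n l)" for l
    have u_comb: "(\<lambda>n. \<Sum>l<t. u n l * b l) sums (\<Sum>l<t. U l * b l)" for b
      unfolding U_def using u_sum by (intro sums_sum sums_mult2 summable_sums) auto
    have w_comb: "(\<lambda>n. \<Sum>l<t. w n l * b l) sums (\<Sum>l<t. W l * b l)" for b
      unfolding W_def using w_sum by (intro sums_sum sums_mult2 summable_sums) auto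

    \<comment> \<open>The only source is the initial mass \<open>c\<close> at \<open>i\<close>; for
      absorbing \<open>i\<close> it lies outside the transient block and the totals vanish.\<close>
    have U: "U j = (if i < t then c * N $$ (i, j) else 0)" if "j < t" for j
    proof -
      have "U j = (\<Sum>l<t. (if l = i then c else 0) * N $$ (l, j))"
        unfolding N
      proof (rule fundamental_matrix_solution[OF Q det _ that])
        fix j assume j: "j < t"
        show "U j = (if j = i then c else 0) + (\<Sum>i<t. U i * Q $$ (i, j))"
          using suminf_linear_recursion[where x = u and y = "\<lambda>n j. 0" and T = "{..<t}" and j = j
              and q = "\<lambda>i j. Q $$ (i, j)"] u_rec u_sum j
          by (simp add: U_def u_def c_def state_mass_0)
      qed
      also have "\<dots> = (\<Sum>l<t. if l = i then c * N $$ (i, j) else 0)"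
        by (intro sum.cong) auto
      finally show ?thesis by simp
    qed
    \<comment> \<open>The reward mass starts at 0, so its source is the total of u n H1 over
      time.\<close>
    have W: "W j = (\<Sum>l<t. (\<Sum>k<t. U k * H\<^sub>1 $$ (k, l)) * N $$ (l, j))" if "j < t" for j
      unfolding N
    proof (rule fundamental_matrix_solution[OF Q det _ that])
      fix j assume j: "j < t"
      note src = u_comb[of "\<lambda>l. H\<^sub>1 $$ (l, j)"]
      have "w 0 j = 0" by (simp add: w_def reward_mass_0)
      then show "W j = (\<Sum>k<t. U k * H\<^sub>1 $$ (k, j)) + (\<Sum>i<t. W i * Q $$ (i, j))"
        using suminf_linear_recursion[where x = w and y = "\<lambda>n j. \<Sum>l<t. u n l * H\<^sub>1 $$ (l, j)"
            and T = "{..<t}" and j = j and q = "\<lambda>i j. Q $$ (i, j)"] w_rec w_sum j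
          sums_summable[OF src] sums_unique[OF src]
        by (simp add: W_def)
    qed

    have "w n j / c = R_hat M S \<Theta> n i j" for n
      by (simp add: R_hat_eq w_def c_def)
    \<comment> \<open>In a transient column the terms of a summable sequence tend to 0; in an
      absorbing column the increments sum to the limit.\<close>
    moreover have "(\<lambda>n. w n j) \<longlonglongrightarrow> c * ?F $$ (i, j)"
    proof (cases "j < t")
      case True
      then have "?F $$ (i, j) = 0" using i N_carrier H2 by auto
      then show ?thesis using summable_LIMSEQ_zero[OF w_sum[OF True]] by simp
    next
      case False
      then obtain k where k: "j = t + k" "k < a" using j by (metis add_less_cancel_left le_Suc_ex not_less)
      let ?L = "(\<Sum>l<t. W l * R $$ (l, k)) + (\<Sum>l<t. U l * H\<^sub>2 $$ (l, k))"
      note sums = sums_add[OF w_comb[of "\<lambda>l. R $$ (l, k)"] u_comb[of "\<lambda>l. H\<^sub>2 $$ (l, k)"]]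
      have "(\<lambda>n. w n (t + k)) \<longlonglongrightarrow> ?L"
        using increment_tendsto[where f = "\<lambda>n. w n (t + k)", OF w_abs[OF k(2)] sums_summable[OF sums]]
        unfolding sums_unique[OF sums, symmetric] by (simp add: w_def reward_mass_0)
      moreover have "?L = c * ?F $$ (i, j)"
      proof (cases "i < t")
        case True
        have NH: "(N * H\<^sub>1) $$ (i, l) = (\<Sum>k<t. N $$ (i, k) * H\<^sub>1 $$ (k, l))" if "l < t" for l
          using True that by (rule index_mult_mat_sum[OF N_carrier H1])
        have NHN: "(N * H\<^sub>1 * N) $$ (i, p) = (\<Sum>l<t. (N * H\<^sub>1) $$ (i, l) * N $$ (l, p))" if "p < t" for p
          using True that by (intro index_mult_mat_sum) (use N_carrier H1 in auto)
        have W': "W p = c * (N * H\<^sub>1 * N) $$ (i, p)" if "p < t" for p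
          using that True
          by (simp add: W U NHN NH sum_distrib_left sum_distrib_right mult.assoc)
        \<comment> \<open>Left bracketing exposes the factor \<open>N * H\<^sub>1 * N\<close>, whose
          row \<open>i\<close>, scaled by \<open>c\<close>, is \<open>W\<close>.\<close>
        have "N * (H\<^sub>2 + H\<^sub>1 * N * R) = N * H\<^sub>2 + N * (H\<^sub>1 * N * R)"
          using N_carrier H1 H2 R by (intro mult_add_distrib_mat) auto
        also have "N * (H\<^sub>1 * N * R) = N * H\<^sub>1 * N * R"
          using N_carrier H1 R by (simp add: assoc_mult_mat[of _ t t _ t _ a] assoc_mult_mat[of _ t t _ t _ t])
        finally have "?F $$ (i, j) = (N * H\<^sub>2 + N * H\<^sub>1 * N * R) $$ (i, k)"
          using True k N_carrier H2 by simp
        also have "\<dots> = (N * H\<^sub>2) $$ (i, k) + (N * H\<^sub>1 * N * R) $$ (i, k)"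
          using True k N_carrier R by simp
        also have "(N * H\<^sub>2) $$ (i, k) = (\<Sum>l<t. N $$ (i, l) * H\<^sub>2 $$ (l, k))"
          using True k(2) by (rule index_mult_mat_sum[OF N_carrier H2])
        also have "(N * H\<^sub>1 * N * R) $$ (i, k) = (\<Sum>p<t. (N * H\<^sub>1 * N) $$ (i, p) * R $$ (p, k))"
          using True k(2) by (intro index_mult_mat_sum) (use N_carrier H1 R in auto)
        finally show ?thesis
          using True by (simp add: U W' sum_distrib_left distrib_left mult.assoc)
      next
        case False
        then have "?F $$ (i, j) = 0" using i k N_carrier H2 by auto
        then show ?thesis using False by (simp add: U W)
      qed
      ultimately show ?thesis by (simp add: k(1))
    qed
    then have "(\<lambda>n. w n j / c) \<longlonglongrightarrow> c * ?F $$ (i, j) / c"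
      using c_pos by (intro tendsto_divide tendsto_const) (auto simp: c_def)
    ultimately show ?thesis using c_pos by (simp add: c_def)
  qed

  show ?thesis
  proof (intro conjI allI impI)
    show "invertible_mat (1\<^sub>m t - Q)" by (rule fundamental_matrix_inverse(1)[OF Q det])
  next
    fix i assume i: "i < t + a" "prob {\<omega> \<in> space M. S 0 \<omega> = i} > 0"
    have "expected_reward M S \<Theta> n i = (\<Sum>j<t + a. R_hat M S \<Theta> n i j)" for n
      by (simp add: expected_reward_eq R_hat_eq sum_divide_distrib)
    moreover have "(\<lambda>n. \<Sum>j<t + a. R_hat M S \<Theta> n i j) \<longlonglongrightarrow> (\<Sum>j<t + a. ?F $$ (i, j))"
      by (intro tendsto_sum limit[OF i]) simp
    ultimately have total: "(\<lambda>n. expected_reward M S \<Theta> n i) \<longlonglongrightarrow> (\<Sum>j<t + a. ?F $$ (i, j))"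
      by presburger
    then show "convergent (\<lambda>n. expected_reward M S \<Theta> n i)" by (rule convergentI)
    show hat: "convergent (\<lambda>n. R_hat M S \<Theta> n i j)" "R_hat_inf M S \<Theta> i j = ?F $$ (i, j)"
      if "j < t + a" for j
      using limit[OF i that] by (auto simp: R_hat_inf_def intro: convergentI limI)
    show "R_bar_inf M S \<Theta> i = (\<Sum>j<t + a. R_hat_inf M S \<Theta> i j)"
      using limI[OF total] by (simp add: R_bar_inf_def hat)
  qed
qed

end
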